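(* Let $F$ be a field with $\mathrm{char}(F)\neq 2$ and let $L$ be a Lie algebra over $F$, with derived algebra $L'=[L,L]$, such that $Z_L(L')=\{0\}$. Then every commuting linear map $f:L\to L$ belongs to $\mathrm{Cent}(L)$.
   Context: $L$ is not assumed finite dimensional. A commuting linear map $f:L\to L$ is an $F$-linear map with $[x,f(x)]=0$ for all $x\in L$. $Z_L(L')=\{v\in L : [s,v]=0\text{ for all } s\in L'\}$. The centroid $\mathrm{Cent}(L)$ is the space of all $F$-linear maps $\gamma:L\to L$ with $\gamma([x,y])=[x,\gamma(y)]$ for all $x,y\in L$. *)

theory Defs
  imports Complex_Main
begin

locale lie_algebra = vector_space scale
  for scale :: "'a::field \<Rightarrow> 'b::ab_group_add \<Rightarrow> 'b" +
  fixes bracket :: "'b \<Rightarrow> 'b \<Rightarrow> 'b"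
  assumes bracket_add_left: "bracket (x + y) z = bracket x z + bracket y z"
    and bracket_add_right: "bracket x (y + z) = bracket x y + bracket x z"
    and bracket_scale_left: "bracket (scale c x) y = scale c (bracket x y)"
    and bracket_scale_right: "bracket x (scale c y) = scale c (bracket x y)"
    and bracket_self: "bracket x x = 0"
    and jacobi: "bracket x (bracket y z) + bracket y (bracket z x) + bracket z (bracket x y) = 0"
begin

definition derived_algebra :: "'b set" where
  "derived_algebra = span {bracket x y | x y. True}"

definition centralizer :: "'b set \<Rightarrow> 'b set" where
  "centralizer S = {v. \<forall>s\<in>S. bracket s v = 0}"

definition commuting_linear_map :: "('b \<Rightarrow> 'b) \<Rightarrow> bool" where
  "commuting_linear_map f \<longleftrightarrow> Vector_Spaces.linear scale scale f \<and> (\<forall>x. bracket x (f x) = 0)"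

definition centroid :: "('b \<Rightarrow> 'b) set" where
  "centroid = {\<gamma>. Vector_Spaces.linear scale scale \<gamma> \<and>
     (\<forall>x y. \<gamma> (bracket x y) = bracket x (\<gamma> y))}"

end

end

(* For a commuting linear map f, B(x, y) = [f x, y] is a skew-symmetric biderivation.
   Expanding B([x, u], [y, v]) in two ways shows that [B(x, y), [u, v]] - [[x, y], B(u, v)] is
   symmetric under swapping y and v; as it is skew in x, y, it vanishes. Hence the alternating map
   T(w, x, y) = B(w, [x, y]) - [w, B(x, y)] satisfies [T(w, x, y), [u, v]] = - [T(w, u, v), [x, y]].
   Up to sign, [T(w, x, y), [u, v]] depends only on the pair {u, v}, and the sign changes along each
   edge of the Petersen graph of disjoint pairs; an odd cycle of that graph forces it to be zero.
   So T takes values in the centralizer of L' and vanishes, that is, f [x, y] - [f x, y] is central,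
   hence zero as well. *)
theory Submission
  imports Defs
begin

lemma two_neq_zero_if_CHAR_neq_2:
  assumes "CHAR('a::idom) \<noteq> 2"
  shows "(2::'a) \<noteq> 0"
proof
  assume "(2::'a) = 0"
  then have "of_nat 2 = (0::'a)" by simp
  then have "CHAR('a) dvd 2" using of_nat_eq_0_iff_char_dvd by blast
  then have "CHAR('a) \<le> 2" "CHAR('a) \<noteq> 0" using dvd_imp_le by (auto intro: Nat.gr0I)
  then have "CHAR('a) = 1" using assms by linarith
  then show False using CHAR_not_1 by simp
qed

lemma (in vector_space) eq_zero_if_eq_uminus_self:
  fixes v :: 'b
  assumes "(2::'a) \<noteq> 0" and "v = - v"
  shows "v = 0"
proof -
  have "scale 2 v = v + v"
    by (metis one_add_one scale_left_distrib scale_one)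
  also have "\<dots> = 0" using assms(2) by (simp add: eq_neg_iff_add_eq_0)
  finally show ?thesis using assms(1) by simp
qed

section \<open>Elementary calculus of the Lie bracket\<close>

context lie_algebra
begin

lemma bracket_zero_left [simp]: "bracket 0 y = 0"
  using bracket_add_left[of 0 0 y] by simp

lemma bracket_zero_right [simp]: "bracket x 0 = 0"
  using bracket_add_right[of x 0 0] by simp

lemma bracket_minus_left [simp]: "bracket (- x) y = - bracket x y"
  using bracket_add_left[of x "- x" y] by (simp add: eq_neg_iff_add_eq_0 add.commute)

lemma bracket_minus_right [simp]: "bracket x (- y) = - bracket x y"
  using bracket_add_right[of x y "- y"] by (simp add: eq_neg_iff_add_eq_0 add.commute)

lemma bracket_diff_left: "bracket (x - y) z = bracket x z - bracket y z"
  using bracket_add_left[of x "- y" z] by simp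

lemma bracket_diff_right: "bracket x (y - z) = bracket x y - bracket x z"
  using bracket_add_right[of x y "- z"] by simp

lemma bracket_skew: "bracket x y = - bracket y x"
proof -
  have "bracket x y + bracket y x = bracket (x + y) (x + y)"
    unfolding bracket_add_left bracket_add_right by (simp add: bracket_self)
  then show ?thesis by (simp only: bracket_self eq_neg_iff_add_eq_0)
qed

text \<open>The Jacobi identity in Leibniz form, the shape in which it is used below.\<close>

lemma bracket_derivation:
  "bracket x (bracket y z) = bracket (bracket x y) z + bracket y (bracket x z)"
proof -
  have "bracket y (bracket z x) = - bracket y (bracket x z)"
    using bracket_minus_right[of y "bracket x z"] bracket_skew[of z x] by simp
  moreover have "bracket z (bracket x y) = - bracket (bracket x y) z"
    by (rule bracket_skew)
  ultimately have "bracket x (bracket y z) - bracket y (bracket x z) - bracket (bracket x y) z = 0"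
    using jacobi[of x y z] by simp
  then show ?thesis by (simp add: algebra_simps)
qed

lemma bracket_bracket_left:
  "bracket (bracket x y) z = bracket x (bracket y z) - bracket y (bracket x z)"
  using bracket_derivation[of x y z] by simp

text \<open>Bracketing with a fixed \<open>v\<close> is linear, so vanishing on the commutators that
  span the derived algebra suffices.\<close>

lemma centralizer_derived_algebra_iff:
  "v \<in> centralizer derived_algebra \<longleftrightarrow> (\<forall>x y. bracket (bracket x y) v = 0)"
proof
  show "\<forall>x y. bracket (bracket x y) v = 0" if "v \<in> centralizer derived_algebra"
  proof (intro allI)
    fix x y
    have "bracket x y \<in> derived_algebra"
      unfolding derived_algebra_def by (rule span_base) blast
    then show "bracket (bracket x y) v = 0"
      using that by (simp add: centralizer_def)
  qed
next
  assume v: "\<forall>x y. bracket (bracket x y) v = 0"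
  have "bracket s v = 0" if "s \<in> derived_algebra" for s
    using that unfolding derived_algebra_def
    by (induction rule: span_induct_alt)
      (use v in \<open>auto simp: bracket_add_left bracket_scale_left\<close>)
  then show "v \<in> centralizer derived_algebra"
    by (simp add: centralizer_def)
qed

end

section \<open>Skew-symmetric biderivations, modelled on [f x, y]\<close>

locale lie_skew_biderivation = lie_algebra scale bracket
  for scale :: "'a::field \<Rightarrow> 'b::ab_group_add \<Rightarrow> 'b" and bracket +
  fixes B :: "'b \<Rightarrow> 'b \<Rightarrow> 'b"
  assumes skew: "B x y = - B y x"
    and derivation_right: "B x (bracket y z) = bracket (B x y) z + bracket y (B x z)"
begin

lemma derivation_left: "B (bracket x y) z = bracket (B x z) y + bracket x (B y z)"
proof -
  have "B (bracket x y) z = - (bracket (B z x) y + bracket x (B z y))"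
    using skew[of "bracket x y" z] derivation_right[of z x y] by simp
  then show ?thesis using skew[of z x] skew[of z y] by simp
qed

definition swap_defect :: "'b \<Rightarrow> 'b \<Rightarrow> 'b \<Rightarrow> 'b \<Rightarrow> 'b" where
  "swap_defect x y u v = bracket (B x y) (bracket u v) - bracket (bracket x y) (B u v)"

lemma swap_defect_skew: "swap_defect x y u v = - swap_defect y x u v"
  using skew[of x y] bracket_skew[of x y] by (simp add: swap_defect_def)

lemma swap_defect_exchange: "swap_defect x y u v = swap_defect x v u y"
proof -
  have "bracket (B (bracket x u) y) v + bracket y (B (bracket x u) v) =
      bracket (B x (bracket y v)) u + bracket x (B u (bracket y v))"
    using derivation_right[of "bracket x u" y v] derivation_left[of x u "bracket y v"] by simp
  then have "bracket (bracket (B x y) u + bracket x (B u y)) v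
      + bracket y (bracket (B x v) u + bracket x (B u v)) =
      bracket (bracket (B x y) v + bracket y (B x v)) u
      + bracket x (bracket (B u y) v + bracket y (B u v))"
    by (simp only: derivation_left derivation_right)
  \<comment> \<open>Each of the four terms on the left is paired with one on the right. The Jacobi
    identity collapses each difference to one bracket of the form met in
    \<open>swap_defect\<close>.\<close>
  moreover have "bracket (B x v) (bracket u y) = - bracket (B x v) (bracket y u)"
    using bracket_skew[of u y] by simp
  moreover have "bracket (bracket (B x y) v) u
      = bracket (bracket (B x y) u) v - bracket (B x y) (bracket u v)"
    using bracket_derivation[of "B x y" u v] bracket_skew[of u "bracket (B x y) v"] by simp
  moreover have "bracket x (bracket y (B u v))
      = bracket (bracket x y) (B u v) + bracket y (bracket x (B u v))"
    by (rule bracket_derivation)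
  moreover have "bracket x (bracket (B u y) v)
      = bracket (bracket x (B u y)) v - bracket (bracket x v) (B u y)"
    using bracket_derivation[of x "B u y" v] bracket_skew[of "B u y" "bracket x v"] by simp
  moreover have "bracket y (bracket (B x v) u)
      = bracket (bracket y (B x v)) u + bracket (B x v) (bracket y u)"
    by (rule bracket_derivation)
  ultimately show ?thesis
    by (simp add: swap_defect_def bracket_add_left bracket_add_right algebra_simps)
qed

text \<open>Exchanging slots 1 and 2 acts with sign -1, exchanging slots 2 and 4 with sign +1. The
  braid relation makes the two transpositions conjugate, so both signs must act alike.\<close>

lemma swap_defect_zero:
  assumes "(2::'a) \<noteq> 0"
  shows "swap_defect x y u v = 0"
proof (rule eq_zero_if_eq_uminus_self[OF assms])
  have "swap_defect x y u v = - swap_defect y x u v" by (rule swap_defect_skew)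
  also have "\<dots> = - swap_defect y v u x" by (subst swap_defect_exchange) simp
  also have "\<dots> = swap_defect v y u x" using swap_defect_skew[of v y] by simp
  also have "\<dots> = swap_defect v x u y" by (rule swap_defect_exchange)
  also have "\<dots> = - swap_defect x v u y" by (rule swap_defect_skew)
  also have "\<dots> = - swap_defect x y u v" by (subst swap_defect_exchange) simp
  finally show "swap_defect x y u v = - swap_defect x y u v" .
qed

lemma bracket_B_bracket:
  assumes "(2::'a) \<noteq> 0"
  shows "bracket (B x y) (bracket u v) = bracket (bracket x y) (B u v)"
  using swap_defect_zero[OF assms, of x y u v] by (simp add: swap_defect_def)

text \<open>The map T of the overview. For \<open>B x y\<close> = [f x, y] its vanishing is the
  centroid condition bracketed with \<open>w\<close>.\<close>

definition defect :: "'b \<Rightarrow> 'b \<Rightarrow> 'b \<Rightarrow> 'b" where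
  "defect w x y = B w (bracket x y) - bracket w (B x y)"

text \<open>By the Leibniz rule the defect is [B w x, y] + [x, B w y] - [w, B x y]. Exchanging
  \<open>w\<close> and \<open>x\<close> negates the first term and turns the other two into each
  other's negatives.\<close>

lemma defect_swap12: "defect w x y = - defect x w y"
proof -
  have "bracket (B w x) y = - bracket (B x w) y"
    using skew[of w x] by simp
  then show ?thesis by (simp add: defect_def derivation_right)
qed

lemma defect_swap23: "defect w x y = - defect w y x"
proof -
  have "B w (bracket x y) = - B w (bracket y x)"
    using bracket_skew[of "B w x" y] bracket_skew[of "B w y" x]
    by (simp add: derivation_right)
  moreover have "bracket w (B x y) = - bracket w (B y x)"
    using skew[of x y] by simp
  ultimately show ?thesis by (simp add: defect_def)
qed

text \<open>A 3-cycle is even. It brings any argument into the first slot, the one that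
  \<open>bracket_defect_bracket\<close> leaves in place.\<close>

lemma defect_rotate: "defect w x y = defect x y w"
  using defect_swap12[of w x y] defect_swap23[of x w y] by simp

text \<open>Expanding both terms of the defect with the Jacobi identity, and moving \<open>B\<close>
  by \<open>bracket_B_bracket\<close>, produces the common term [w, [[x, y], B u v]], which
  cancels.\<close>

lemma bracket_defect_bracket:
  assumes "(2::'a) \<noteq> 0"
  shows "bracket (defect w x y) (bracket u v) = - bracket (defect w u v) (bracket x y)"
proof -
  note B = bracket_B_bracket[OF assms]
  have "bracket (bracket w (B x y)) (bracket u v)
      = bracket w (bracket (bracket x y) (B u v)) - bracket (bracket x y) (B w (bracket u v))"
    by (simp add: bracket_bracket_left[of w "B x y"] B)
  moreover have "bracket (B w (bracket x y)) (bracket u v)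
      = bracket w (bracket (bracket x y) (B u v)) - bracket (bracket x y) (bracket w (B u v))"
    by (simp only: B bracket_bracket_left[of w "bracket x y"])
  ultimately have "bracket (defect w x y) (bracket u v) = bracket (bracket x y) (defect w u v)"
    by (simp add: defect_def bracket_diff_left bracket_diff_right)
  then show ?thesis using bracket_skew by metis
qed

lemma bracket_defect_eq_zero:
  assumes "(2::'a) \<noteq> 0"
  shows "bracket (defect w x y) (bracket u v) = 0"
proof (rule eq_zero_if_eq_uminus_self[OF assms])
  note swap = bracket_defect_bracket[OF assms]
  \<comment> \<open>Along the 5-cycle uv, xy, vw, ux, wy of disjoint pairs.\<close>
  have "bracket (defect w x y) (bracket u v) = - bracket (defect u v w) (bracket x y)"
    by (simp only: swap[of w x y u v] defect_rotate[of w u v])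
  also have "\<dots> = bracket (defect y u x) (bracket v w)"
    by (simp only: swap[of u v w x y] defect_rotate[of y u x] minus_minus)
  also have "\<dots> = - bracket (defect v w y) (bracket u x)"
    by (simp only: swap[of y u x v w] defect_rotate[of y v w])
  also have "\<dots> = bracket (defect x v u) (bracket w y)"
    by (simp only: swap[of v w y u x] defect_rotate[of x v u] minus_minus)
  also have "\<dots> = - bracket (defect x w y) (bracket v u)"
    by (rule swap)
  \<comment> \<open>The cycle closes with two transpositions whose signs cancel, so the sign of the
    five edges survives.\<close>
  also have "\<dots> = - bracket (defect w x y) (bracket u v)"
    by (simp add: defect_swap12[of x w y] bracket_skew[of v u])
  finally show "bracket (defect w x y) (bracket u v) = - bracket (defect w x y) (bracket u v)" .
qed

lemma B_bracket_eq:
  assumes "(2::'a) \<noteq> 0" and "centralizer derived_algebra = {0}"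
  shows "B w (bracket x y) = bracket w (B x y)"
proof -
  have "bracket (bracket u v) (defect w x y) = 0" for u v
    using bracket_defect_eq_zero[OF assms(1)] bracket_skew by (metis minus_zero)
  then have "defect w x y \<in> centralizer derived_algebra"
    by (simp add: centralizer_derived_algebra_iff)
  then show ?thesis using assms(2) by (simp add: defect_def)
qed

end

context lie_algebra
begin

text \<open>Polarization of [x, f x] = 0 at \<open>x + y\<close>.\<close>

lemma commuting_linear_map_skew:
  assumes "commuting_linear_map f"
  shows "bracket x (f y) = bracket (f x) y"
proof -
  have "f (x + y) = f x + f y"
    using assms by (simp add: commuting_linear_map_def Vector_Spaces.linear_iff)
  moreover have "bracket x (f x) = 0" "bracket y (f y) = 0" "bracket (x + y) (f (x + y)) = 0"
    using assms by (simp_all only: commuting_linear_map_def)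
  ultimately have "bracket x (f y) + bracket y (f x) = 0"
    by (simp add: bracket_add_left bracket_add_right add.commute)
  then show ?thesis using bracket_skew[of "f x" y] by (simp add: add_eq_0_iff2)
qed

lemma commuting_linear_map_lie_skew_biderivation:
  assumes "commuting_linear_map f"
  shows "lie_skew_biderivation scale bracket (\<lambda>x. bracket (f x))"
proof unfold_locales
  show "bracket (f x) y = - bracket (f y) x" for x y
    using commuting_linear_map_skew[OF assms] bracket_skew by metis
  show "bracket (f x) (bracket y z) = bracket (bracket (f x) y) z + bracket y (bracket (f x) z)"
    for x y z
    by (rule bracket_derivation)
qed

lemma commuting_linear_map_in_centroid:
  assumes "(2::'a) \<noteq> 0" and "centralizer derived_algebra = {0}" and f: "commuting_linear_map f"
  shows "f \<in> centroid"
proof -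
  interpret lie_skew_biderivation scale bracket "\<lambda>x. bracket (f x)"
    by (rule commuting_linear_map_lie_skew_biderivation[OF f])
  have "f (bracket x y) = bracket x (f y)" for x y
  proof -
    \<comment> \<open>\<open>B_bracket_eq\<close> reads [f w, [x, y]] = [w, [f x, y]];
      \<open>f\<close> is then moved across the brackets.\<close>
    have "bracket w (f (bracket x y)) = bracket w (bracket x (f y))" for w
      using B_bracket_eq[OF assms(1,2), of w x y] by (simp add: commuting_linear_map_skew[OF f])
    \<comment> \<open>A central element centralizes the derived algebra in particular, so the
      centralizer hypothesis applies a second time.\<close>
    then have "f (bracket x y) - bracket x (f y) \<in> centralizer derived_algebra"
      by (simp add: centralizer_def bracket_diff_right)
    then show ?thesis using assms(2) by simp
  qed
  then show ?thesis using f by (simp add: centroid_def commuting_linear_map_def)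
qed

end

theorem corollary3p3:
  fixes scale :: "'a::field \<Rightarrow> 'b::ab_group_add \<Rightarrow> 'b"
    and bracket :: "'b \<Rightarrow> 'b \<Rightarrow> 'b"
    and f :: "'b \<Rightarrow> 'b"
  assumes "lie_algebra scale bracket"
    and "CHAR('a) \<noteq> 2"
    and "lie_algebra.centralizer bracket (lie_algebra.derived_algebra scale bracket) = {0}"
    and "lie_algebra.commuting_linear_map scale bracket f"
  shows "f \<in> lie_algebra.centroid scale bracket"
  using lie_algebra.commuting_linear_map_in_centroid[OF assms(1)]
    two_neq_zero_if_CHAR_neq_2[OF assms(2)] assms(3,4) by blast

end
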